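(* Let $L$ be a finite-dimensional perfect diassociative algebra. Then the extension $E:0\to 0\to L\xrightarrow{\mathrm{id}} L\to 0$ is universal if and only if every central extension of $L$ splits.
   Context: All algebras are over a fixed field $\mathbb{F}$. A diassociative algebra is a vector space $L$ with two bilinear associative products $\dashv,\vdash$ satisfying, for all $x,y,z\in L$: $x\dashv(y\dashv z)=x\dashv(y\vdash z)$, $(x\vdash y)\dashv z=x\vdash(y\dashv z)$, $(x\dashv y)\vdash z=(x\vdash y)\vdash z$. Homomorphisms are linear maps preserving both products. For subalgebras $S,T$ of $L$, $S\lozenge T=S\dashv T+S\vdash T$ (linear span of all products $s\dashv t$ and $s\vdash t$). $L'=L\lozenge L$, and $L$ is perfect if $L=L'$. The center $Z(L)$ is the set of $z\in L$ with $z\dashv x=x\dashv z=z\vdash x=x\vdash z=0$ for all $x\in L$. An extension of $A$ by $L$ is a short exact sequence $0\to A\to H\xrightarrow{\phi} L\to 0$ of diassociative algebras and homomorphisms, where the map $A\to H$ is taken to be the inclusion (so $A=\ker\phi$). It is central if $A\subseteq Z(H)$; it is then called a central extension of $L$. A central extension $E:0\to A\to H\xrightarrow{\phi} L\to 0$ covers a central extension $E_1:0\to A_1\to H_1\xrightarrow{\phi_1} L\to 0$ if there is a homomorphism $\tau:H\to H_1$ making the diagram with vertical maps $\tau|_A,\tau,\mathrm{id}_L$ commute (i.e. $\phi_1\circ\tau=\phi$); it uniquely covers $E_1$ if moreover such $\tau$ is unique. A central extension $E$ of $L$ is universal if it uniquely covers every central extension of $L$. An extension $0\to A\to H\xrightarrow{\phi}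 L\to 0$ splits if there is a homomorphism $\mu:L\to H$ with $\phi\circ\mu=\mathrm{id}_L$. *)

theory Defs
  imports "HOL-Algebra.Algebra"
begin

text \<open>
  Algebras have explicit carriers, over a field \<open>F\<close> in the sense of HOL-Algebra.
  The record extends the HOL-Algebra module record, whose (unused) ring multiplication and unit
  carry no assumptions here.
\<close>

record ('f, 'v) dialg = "('f, 'v) module" +
  lprod :: "'v \<Rightarrow> 'v \<Rightarrow> 'v" (infixl \<open>\<stileturn>\<index>\<close> 70)
  rprod :: "'v \<Rightarrow> 'v \<Rightarrow> 'v" (infixl \<open>\<turnstile>\<index>\<close> 70)

definition bilinear_on :: "('f, 'm) ring_scheme \<Rightarrow> ('f, 'v, 'n) module_scheme
    \<Rightarrow> ('v \<Rightarrow> 'v \<Rightarrow> 'v) \<Rightarrow> bool"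
  where "bilinear_on F V p \<longleftrightarrow>
    (\<forall>x\<in>carrier V. \<forall>y\<in>carrier V. p x y \<in> carrier V) \<and>
    (\<forall>x\<in>carrier V. \<forall>y\<in>carrier V. \<forall>z\<in>carrier V.
       p (x \<oplus>\<^bsub>V\<^esub> y) z = p x z \<oplus>\<^bsub>V\<^esub> p y z \<and>
       p x (y \<oplus>\<^bsub>V\<^esub> z) = p x y \<oplus>\<^bsub>V\<^esub> p x z) \<and>
    (\<forall>a\<in>carrier F. \<forall>x\<in>carrier V. \<forall>y\<in>carrier V.
       p (a \<odot>\<^bsub>V\<^esub> x) y = a \<odot>\<^bsub>V\<^esub> p x y \<and>
       p x (a \<odot>\<^bsub>V\<^esub> y) = a \<odot>\<^bsub>V\<^esub> p x y)"

locale diassociative_algebra = field F + module F L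
  for F :: "('f, 'm) ring_scheme" and L :: "('f, 'v) dialg" (structure) +
  assumes lprod_bilinear: "bilinear_on F L (lprod L)"
    and rprod_bilinear: "bilinear_on F L (rprod L)"
    and lprod_assoc: "\<lbrakk>x \<in> carrier L; y \<in> carrier L; z \<in> carrier L\<rbrakk>
      \<Longrightarrow> (x \<stileturn> y) \<stileturn> z = x \<stileturn> (y \<stileturn> z)"
    and rprod_assoc: "\<lbrakk>x \<in> carrier L; y \<in> carrier L; z \<in> carrier L\<rbrakk>
      \<Longrightarrow> (x \<turnstile> y) \<turnstile> z = x \<turnstile> (y \<turnstile> z)"
    and left_axiom: "\<lbrakk>x \<in> carrier L; y \<in> carrier L; z \<in> carrier L\<rbrakk>
      \<Longrightarrow> x \<stileturn> (y \<stileturn> z) = x \<stileturn> (y \<turnstile> z)"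
    and middle_axiom: "\<lbrakk>x \<in> carrier L; y \<in> carrier L; z \<in> carrier L\<rbrakk>
      \<Longrightarrow> (x \<turnstile> y) \<stileturn> z = x \<turnstile> (y \<stileturn> z)"
    and right_axiom: "\<lbrakk>x \<in> carrier L; y \<in> carrier L; z \<in> carrier L\<rbrakk>
      \<Longrightarrow> (x \<stileturn> y) \<turnstile> z = (x \<turnstile> y) \<turnstile> z"

definition linear_span :: "('f, 'm) ring_scheme \<Rightarrow> ('f, 'v, 'n) module_scheme \<Rightarrow> 'v set \<Rightarrow> 'v set"
  where "linear_span F V B = (\<lambda>N. submodule N F V) hull B"

definition finite_dimensional :: "('f, 'm) ring_scheme \<Rightarrow> ('f, 'v, 'n) module_scheme \<Rightarrow> bool"
  where "finite_dimensional F V \<longleftrightarrow>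
    (\<exists>B. finite B \<and> B \<subseteq> carrier V \<and> linear_span F V B = carrier V)"

definition lozenge :: "('f, 'm) ring_scheme \<Rightarrow> ('f, 'v) dialg \<Rightarrow> 'v set \<Rightarrow> 'v set \<Rightarrow> 'v set"
  where "lozenge F L S T =
    linear_span F L ({s \<stileturn>\<^bsub>L\<^esub> t | s t. s \<in> S \<and> t \<in> T} \<union> {s \<turnstile>\<^bsub>L\<^esub> t | s t. s \<in> S \<and> t \<in> T})"

definition perfect :: "('f, 'm) ring_scheme \<Rightarrow> ('f, 'v) dialg \<Rightarrow> bool"
  where "perfect F L \<longleftrightarrow> carrier L = lozenge F L (carrier L) (carrier L)"

definition dialg_center :: "('f, 'v) dialg \<Rightarrow> 'v set"
  where "dialg_center L = {z \<in> carrier L. \<forall>x\<in>carrier L.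
    z \<stileturn>\<^bsub>L\<^esub> x = \<zero>\<^bsub>L\<^esub> \<and> x \<stileturn>\<^bsub>L\<^esub> z = \<zero>\<^bsub>L\<^esub> \<and>
    z \<turnstile>\<^bsub>L\<^esub> x = \<zero>\<^bsub>L\<^esub> \<and> x \<turnstile>\<^bsub>L\<^esub> z = \<zero>\<^bsub>L\<^esub>}"

definition dialg_hom :: "('f, 'm) ring_scheme \<Rightarrow> ('f, 'v) dialg \<Rightarrow> ('f, 'w) dialg \<Rightarrow> ('v \<Rightarrow> 'w) set"
  where "dialg_hom F H K = {f \<in> carrier H \<rightarrow> carrier K.
    (\<forall>x\<in>carrier H. \<forall>y\<in>carrier H.
       f (x \<oplus>\<^bsub>H\<^esub> y) = f x \<oplus>\<^bsub>K\<^esub> f y \<and>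
       f (x \<stileturn>\<^bsub>H\<^esub> y) = f x \<stileturn>\<^bsub>K\<^esub> f y \<and>
       f (x \<turnstile>\<^bsub>H\<^esub> y) = f x \<turnstile>\<^bsub>K\<^esub> f y) \<and>
    (\<forall>a\<in>carrier F. \<forall>x\<in>carrier H. f (a \<odot>\<^bsub>H\<^esub> x) = a \<odot>\<^bsub>K\<^esub> f x)}"

text \<open>
  \<open>extension F A H \<phi> L\<close>: the sequence \<open>0 \<rightarrow> A \<rightarrow> H \<rightarrow> L \<rightarrow> 0\<close> with the inclusion and \<open>\<phi>\<close> as its maps
  is a short exact sequence.
\<close>

definition extension :: "('f, 'm) ring_scheme \<Rightarrow> ('f, 'h) dialg \<Rightarrow> ('f, 'h) dialg
    \<Rightarrow> ('h \<Rightarrow> 'a) \<Rightarrow> ('f, 'a) dialg \<Rightarrow> bool"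
  where "extension F A H \<phi> L \<longleftrightarrow>
    diassociative_algebra F A \<and> diassociative_algebra F H \<and> diassociative_algebra F L \<and>
    (\<lambda>x. x) \<in> dialg_hom F A H \<and> \<phi> \<in> dialg_hom F H L \<and>
    \<phi> ` carrier H = carrier L \<and> carrier A = {x \<in> carrier H. \<phi> x = \<zero>\<^bsub>L\<^esub>}"

definition central_extension :: "('f, 'm) ring_scheme \<Rightarrow> ('f, 'h) dialg \<Rightarrow> ('f, 'h) dialg
    \<Rightarrow> ('h \<Rightarrow> 'a) \<Rightarrow> ('f, 'a) dialg \<Rightarrow> bool"
  where "central_extension F A H \<phi> L \<longleftrightarrow> extension F A H \<phi> L \<and> carrier A \<subseteq> dialg_center H"

text \<open>
  The homomorphisms completing the diagram from \<open>(H, \<phi>)\<close> to \<open>(H\<^sub>1, \<phi>\<^sub>1)\<close> over the identity of \<open>L\<close>;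
  that they map the kernel of \<open>\<phi>\<close> into that of \<open>\<phi>\<^sub>1\<close> is automatic.
\<close>

definition covering_homs :: "('f, 'm) ring_scheme \<Rightarrow> ('f, 'g) dialg \<Rightarrow> ('g \<Rightarrow> 'a)
    \<Rightarrow> ('f, 'h) dialg \<Rightarrow> ('h \<Rightarrow> 'a) \<Rightarrow> ('g \<Rightarrow> 'h) set"
  where "covering_homs F H \<phi> H\<^sub>1 \<phi>\<^sub>1 = {\<tau> \<in> dialg_hom F H H\<^sub>1. \<forall>x\<in>carrier H. \<phi>\<^sub>1 (\<tau> x) = \<phi> x}"

definition covers :: "('f, 'm) ring_scheme \<Rightarrow> ('f, 'g) dialg \<Rightarrow> ('g \<Rightarrow> 'a)
    \<Rightarrow> ('f, 'h) dialg \<Rightarrow> ('h \<Rightarrow> 'a) \<Rightarrow> bool"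
  where "covers F H \<phi> H\<^sub>1 \<phi>\<^sub>1 \<longleftrightarrow> (\<exists>\<tau>. \<tau> \<in> covering_homs F H \<phi> H\<^sub>1 \<phi>\<^sub>1)"

text \<open>Maps are HOL functions, so they are compared on the carrier only.\<close>

definition uniquely_covers :: "('f, 'm) ring_scheme \<Rightarrow> ('f, 'g) dialg \<Rightarrow> ('g \<Rightarrow> 'a)
    \<Rightarrow> ('f, 'h) dialg \<Rightarrow> ('h \<Rightarrow> 'a) \<Rightarrow> bool"
  where "uniquely_covers F H \<phi> H\<^sub>1 \<phi>\<^sub>1 \<longleftrightarrow> covers F H \<phi> H\<^sub>1 \<phi>\<^sub>1 \<and>
    (\<forall>\<tau>\<in>covering_homs F H \<phi> H\<^sub>1 \<phi>\<^sub>1. \<forall>\<tau>'\<in>covering_homs F H \<phi> H\<^sub>1 \<phi>\<^sub>1. \<forall>x\<in>carrier H. \<tau> x = \<tau>' x)"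

text \<open>
  HOL cannot quantify over types inside a formula, so the extensions against which universality is
  tested range over all those with elements in an arbitrary type \<open>'h\<close>, which is a parameter.
\<close>

definition universal_central_extension :: "'h itself \<Rightarrow> ('f, 'm) ring_scheme
    \<Rightarrow> ('f, 'g) dialg \<Rightarrow> ('f, 'g) dialg \<Rightarrow> ('g \<Rightarrow> 'a) \<Rightarrow> ('f, 'a) dialg \<Rightarrow> bool"
  where "universal_central_extension (_ :: 'h itself) F A H \<phi> L \<longleftrightarrow> central_extension F A H \<phi> L \<and>
    (\<forall>(A\<^sub>1 :: ('f, 'h) dialg) H\<^sub>1 \<phi>\<^sub>1.
       central_extension F A\<^sub>1 H\<^sub>1 \<phi>\<^sub>1 L \<longrightarrow> uniquely_covers F H \<phi> H\<^sub>1 \<phi>\<^sub>1)"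

definition splits :: "('f, 'm) ring_scheme \<Rightarrow> ('f, 'h) dialg \<Rightarrow> ('h \<Rightarrow> 'a) \<Rightarrow> ('f, 'a) dialg \<Rightarrow> bool"
  where "splits F H \<phi> L \<longleftrightarrow> (\<exists>\<mu>\<in>dialg_hom F L H. \<forall>x\<in>carrier L. \<phi> (\<mu> x) = x)"

definition zero_subalgebra :: "('f, 'v) dialg \<Rightarrow> ('f, 'v) dialg"
  where "zero_subalgebra L = L\<lparr>carrier := {\<zero>\<^bsub>L\<^esub>}\<rparr>"

end

theory Submission
  imports Defs
begin

text \<open>
  A covering of a central extension \<open>\<phi> : H \<rightarrow> L\<close> by the identity of \<open>L\<close> is the same thing as a
  section of \<open>\<phi>\<close>, so covering means splitting, and the substance is that for perfect \<open>L\<close> a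
  covering is automatically unique. In a central extension the product of two elements depends
  only on their images in \<open>L\<close>, because changing a factor within a fibre of \<open>\<phi>\<close> adds an element
  of the kernel, which is central. Hence two homomorphisms lying over the same map agree on all
  products (\<open>covering_homs_eq_on_products\<close>); the set on which they agree is a subspace, and a
  perfect algebra is the span of its products (\<open>covering_homs_unique_if_perfect\<close>).
\<close>

lemma bilinear_on_zero:
  assumes "module F V" "bilinear_on F V p" "x \<in> carrier V"
  shows "p \<zero>\<^bsub>V\<^esub> x = \<zero>\<^bsub>V\<^esub>" "p x \<zero>\<^bsub>V\<^esub> = \<zero>\<^bsub>V\<^esub>"
proof -
  interpret module F V by fact
  have closed: "p u v \<in> carrier V" if "u \<in> carrier V" "v \<in> carrier V" for u v
    using assms(2) that unfolding bilinear_on_def by blast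
  have "p (\<zero>\<^bsub>F\<^esub> \<odot>\<^bsub>V\<^esub> x) x = \<zero>\<^bsub>F\<^esub> \<odot>\<^bsub>V\<^esub> p x x" "p x (\<zero>\<^bsub>F\<^esub> \<odot>\<^bsub>V\<^esub> x) = \<zero>\<^bsub>F\<^esub> \<odot>\<^bsub>V\<^esub> p x x"
    using assms(2,3) R.zero_closed unfolding bilinear_on_def by blast+
  then show "p \<zero>\<^bsub>V\<^esub> x = \<zero>\<^bsub>V\<^esub>" "p x \<zero>\<^bsub>V\<^esub> = \<zero>\<^bsub>V\<^esub>"
    using assms(3) closed by simp_all
qed

lemma diassociative_algebra_zero_subalgebra:
  assumes "diassociative_algebra F L"
  shows "diassociative_algebra F (zero_subalgebra L)"
proof -
  interpret diassociative_algebra F L by fact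
  have zero_products [simp]:
    "\<zero>\<^bsub>L\<^esub> \<stileturn>\<^bsub>L\<^esub> \<zero>\<^bsub>L\<^esub> = \<zero>\<^bsub>L\<^esub>" "\<zero>\<^bsub>L\<^esub> \<turnstile>\<^bsub>L\<^esub> \<zero>\<^bsub>L\<^esub> = \<zero>\<^bsub>L\<^esub>"
    using bilinear_on_zero[OF module_axioms] lprod_bilinear rprod_bilinear by simp_all
  have "abelian_group (zero_subalgebra L)"
    by (rule abelian_groupI) (simp_all add: zero_subalgebra_def)
  then have "module F (zero_subalgebra L)"
    by (intro module.intro module_axioms.intro) (simp_all add: is_cring zero_subalgebra_def)
  then show ?thesis
    by (intro diassociative_algebra.intro diassociative_algebra_axioms.intro)
      (simp_all add: field_axioms bilinear_on_def zero_subalgebra_def)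
qed

lemma zero_in_dialg_center:
  assumes "diassociative_algebra F L"
  shows "\<zero>\<^bsub>L\<^esub> \<in> dialg_center L"
proof -
  interpret diassociative_algebra F L by fact
  show ?thesis
    using bilinear_on_zero[OF module_axioms] lprod_bilinear rprod_bilinear
    by (simp add: dialg_center_def)
qed

lemma central_extension_zero_subalgebra:
  assumes "diassociative_algebra F L"
  shows "central_extension F (zero_subalgebra L) L (\<lambda>x. x) L"
proof -
  interpret diassociative_algebra F L by fact
  show ?thesis
    using assms diassociative_algebra_zero_subalgebra[OF assms] zero_in_dialg_center[OF assms]
    by (auto simp: central_extension_def extension_def dialg_hom_def zero_subalgebra_def)
qed

lemma covers_from_id_iff_splits: "covers F L (\<lambda>x. x) H \<phi> \<longleftrightarrow> splits F H \<phi> L"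
  by (auto simp: covers_def splits_def covering_homs_def)

text \<open>
  Writing \<open>u = z + u'\<close> with \<open>z\<close> in the kernel of \<open>\<phi>\<close>, and likewise for \<open>v\<close>, bilinearity leaves
  \<open>u'v'\<close> plus terms with a central factor.
\<close>

lemma central_extension_products_eq:
  assumes ext: "central_extension F A H \<phi> L"
    and carr: "u \<in> carrier H" "u' \<in> carrier H" "v \<in> carrier H" "v' \<in> carrier H"
    and fibres: "\<phi> u = \<phi> u'" "\<phi> v = \<phi> v'"
  shows "u \<stileturn>\<^bsub>H\<^esub> v = u' \<stileturn>\<^bsub>H\<^esub> v'" "u \<turnstile>\<^bsub>H\<^esub> v = u' \<turnstile>\<^bsub>H\<^esub> v'"
proof -
  interpret H: diassociative_algebra F H
    using ext by (simp add: central_extension_def extension_def)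
  interpret L: diassociative_algebra F L
    using ext by (simp add: central_extension_def extension_def)
  have hom: "\<phi> \<in> dialg_hom F H L" and ker: "{x \<in> carrier H. \<phi> x = \<zero>\<^bsub>L\<^esub>} \<subseteq> dialg_center H"
    using ext by (auto simp: central_extension_def extension_def)
  have decomp: "\<exists>z\<in>dialg_center H. x = z \<oplus>\<^bsub>H\<^esub> y"
    if "x \<in> carrier H" "y \<in> carrier H" "\<phi> x = \<phi> y" for x y
  proof
    show x: "x = (x \<ominus>\<^bsub>H\<^esub> y) \<oplus>\<^bsub>H\<^esub> y"
      using that by (simp add: H.M.minus_eq H.M.a_assoc H.M.l_neg)
    have "\<phi> ((x \<ominus>\<^bsub>H\<^esub> y) \<oplus>\<^bsub>H\<^esub> y) = \<phi> (x \<ominus>\<^bsub>H\<^esub> y) \<oplus>\<^bsub>L\<^esub> \<phi> y"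
      using hom that(2) H.M.minus_closed[OF that(1,2)] unfolding dialg_hom_def by blast
    then have "\<phi> x = \<phi> (x \<ominus>\<^bsub>H\<^esub> y) \<oplus>\<^bsub>L\<^esub> \<phi> y"
      by (simp only: x[symmetric])
    moreover have "\<phi> (x \<ominus>\<^bsub>H\<^esub> y) \<in> carrier L" "\<phi> y \<in> carrier L"
      using hom that unfolding dialg_hom_def by auto
    ultimately have "\<phi> (x \<ominus>\<^bsub>H\<^esub> y) = \<zero>\<^bsub>L\<^esub>"
      using that(3) by (metis L.M.add.r_cancel_one')
    then show "x \<ominus>\<^bsub>H\<^esub> y \<in> dialg_center H"
      using ker that by auto
  qed
  obtain z w where zw: "z \<in> dialg_center H" "u = z \<oplus>\<^bsub>H\<^esub> u'" "w \<in> dialg_center H" "v = w \<oplus>\<^bsub>H\<^esub> v'"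
    using decomp[of u u'] decomp[of v v'] carr fibres by blast
  have mem: "z \<in> carrier H" "w \<in> carrier H"
    using zw by (auto simp: dialg_center_def)
  have prod_eq: "p u v = p u' v'"
    if p: "bilinear_on F H p"
      and central: "\<And>x. x \<in> carrier H \<Longrightarrow> p z x = \<zero>\<^bsub>H\<^esub>" "\<And>x. x \<in> carrier H \<Longrightarrow> p x w = \<zero>\<^bsub>H\<^esub>" for p
  proof -
    have "p u v = p z v \<oplus>\<^bsub>H\<^esub> p u' v"
      using p zw(2) mem carr unfolding bilinear_on_def by blast
    moreover have "p u' v = p u' w \<oplus>\<^bsub>H\<^esub> p u' v'"
      using p zw(4) mem carr unfolding bilinear_on_def by blast
    moreover have "p u' v' \<in> carrier H"
      using p carr unfolding bilinear_on_def by blast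
    ultimately show ?thesis
      using carr central by simp
  qed
  show "u \<stileturn>\<^bsub>H\<^esub> v = u' \<stileturn>\<^bsub>H\<^esub> v'" "u \<turnstile>\<^bsub>H\<^esub> v = u' \<turnstile>\<^bsub>H\<^esub> v'"
    using zw(1,3) by (auto intro!: prod_eq H.lprod_bilinear H.rprod_bilinear simp: dialg_center_def)
qed

lemma covering_homs_eq_on_products:
  assumes "central_extension F A H \<phi> L"
    and "\<tau> \<in> covering_homs F G \<psi> H \<phi>" "\<tau>' \<in> covering_homs F G \<psi> H \<phi>"
    and "x \<in> carrier G" "y \<in> carrier G"
  shows "\<tau> (x \<stileturn>\<^bsub>G\<^esub> y) = \<tau>' (x \<stileturn>\<^bsub>G\<^esub> y)" "\<tau> (x \<turnstile>\<^bsub>G\<^esub> y) = \<tau>' (x \<turnstile>\<^bsub>G\<^esub> y)"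
proof -
  have "\<tau> x \<in> carrier H" "\<tau>' x \<in> carrier H" "\<tau> y \<in> carrier H" "\<tau>' y \<in> carrier H"
    and "\<phi> (\<tau> x) = \<phi> (\<tau>' x)" "\<phi> (\<tau> y) = \<phi> (\<tau>' y)"
    using assms(2-5) by (auto simp: covering_homs_def dialg_hom_def)
  from central_extension_products_eq[OF assms(1) this]
  show "\<tau> (x \<stileturn>\<^bsub>G\<^esub> y) = \<tau>' (x \<stileturn>\<^bsub>G\<^esub> y)" "\<tau> (x \<turnstile>\<^bsub>G\<^esub> y) = \<tau>' (x \<turnstile>\<^bsub>G\<^esub> y)"
    using assms(2-5) by (auto simp: covering_homs_def dialg_hom_def)
qed

lemma submodule_equalizer:
  assumes "diassociative_algebra F G" "diassociative_algebra F H"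
    and f: "f \<in> dialg_hom F G H" and g: "g \<in> dialg_hom F G H"
  shows "submodule {x \<in> carrier G. f x = g x} F G"
proof -
  interpret G: diassociative_algebra F G by fact
  interpret H: diassociative_algebra F H by fact
  \<comment> \<open>Zero and negatives are handled as the scalar multiples by \<open>0\<close> and \<open>-1\<close>.\<close>
  have smult: "a \<odot>\<^bsub>G\<^esub> x \<in> {x \<in> carrier G. f x = g x}"
    if "a \<in> carrier F" "x \<in> {x \<in> carrier G. f x = g x}" for a x
    using f g that by (auto simp: dialg_hom_def)
  have zero: "\<zero>\<^bsub>G\<^esub> \<in> {x \<in> carrier G. f x = g x}"
  proof -
    have "h \<zero>\<^bsub>G\<^esub> = \<zero>\<^bsub>H\<^esub>" if "h \<in> dialg_hom F G H" for h
    proof -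
      have "h (\<zero>\<^bsub>F\<^esub> \<odot>\<^bsub>G\<^esub> \<zero>\<^bsub>G\<^esub>) = \<zero>\<^bsub>F\<^esub> \<odot>\<^bsub>H\<^esub> h \<zero>\<^bsub>G\<^esub>" "h \<zero>\<^bsub>G\<^esub> \<in> carrier H"
        using that G.zero_closed G.M.zero_closed unfolding dialg_hom_def by blast+
      then show ?thesis by simp
    qed
    from this[OF f] this[OF g] show ?thesis by simp
  qed
  have neg: "\<ominus>\<^bsub>G\<^esub> x \<in> {x \<in> carrier G. f x = g x}" if "x \<in> {x \<in> carrier G. f x = g x}" for x
    using smult[of "\<ominus>\<^bsub>F\<^esub> \<one>\<^bsub>F\<^esub>" x] that by (simp add: G.smult_l_minus)
  show ?thesis
  proof (rule G.submoduleI)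
    fix x y assume "x \<in> {x \<in> carrier G. f x = g x}" "y \<in> {x \<in> carrier G. f x = g x}"
    then show "x \<oplus>\<^bsub>G\<^esub> y \<in> {x \<in> carrier G. f x = g x}"
      using f g by (auto simp: dialg_hom_def)
  qed (use zero neg smult in auto)
qed

lemma covering_homs_unique_if_perfect:
  assumes ext: "central_extension F A H \<phi> L"
    and G: "diassociative_algebra F G" "perfect F G"
    and \<tau>: "\<tau> \<in> covering_homs F G \<psi> H \<phi>" "\<tau>' \<in> covering_homs F G \<psi> H \<phi>"
    and x: "x \<in> carrier G"
  shows "\<tau> x = \<tau>' x"
proof -
  interpret G: diassociative_algebra F G by fact
  let ?E = "{x \<in> carrier G. \<tau> x = \<tau>' x}"
  have "submodule ?E F G"
    using submodule_equalizer[OF G(1)] ext \<tau>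
    by (auto simp: central_extension_def extension_def covering_homs_def)
  moreover have "s \<stileturn>\<^bsub>G\<^esub> t \<in> ?E" "s \<turnstile>\<^bsub>G\<^esub> t \<in> ?E" if "s \<in> carrier G" "t \<in> carrier G" for s t
    using covering_homs_eq_on_products[OF ext \<tau> that] that G.lprod_bilinear G.rprod_bilinear
    by (auto simp: bilinear_on_def)
  ultimately have "lozenge F G (carrier G) (carrier G) \<subseteq> ?E"
    unfolding lozenge_def linear_span_def by (intro hull_minimal) auto
  then show ?thesis
    using G(2) x unfolding perfect_def by blast
qed

theorem lemma2p4:
  fixes F :: "('f, 'm) ring_scheme" and L :: "('f, 'a) dialg"
  assumes "diassociative_algebra F L"
    and "finite_dimensional F L"
    and "perfect F L"
  shows "universal_central_extension TYPE('h) F (zero_subalgebra L) L (\<lambda>x. x) L \<longleftrightarrow>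
    (\<forall>(A :: ('f, 'h) dialg) H \<phi>. central_extension F A H \<phi> L \<longrightarrow> splits F H \<phi> L)"
proof -
  have "uniquely_covers F L (\<lambda>x. x) H \<phi> \<longleftrightarrow> splits F H \<phi> L"
    if "central_extension F A H \<phi> L" for A H :: "('f, 'h) dialg" and \<phi>
    using covering_homs_unique_if_perfect[OF that assms(1,3)]
    by (auto simp: uniquely_covers_def covers_from_id_iff_splits)
  then show ?thesis
    using central_extension_zero_subalgebra[OF assms(1)]
    unfolding universal_central_extension_def by blast
qed

end
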